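(* Let $\mathcal{F}$ be a family of disconnected graphs, and let $H \in \mathcal{F}$ be a graph of maximum order in $\mathcal{F}$. Then any optimal online algorithm with advice for the Delayed $\mathcal{F}$-Node-Deletion Problem needs $\mathrm{opt} \cdot \log |H|$ bits of advice.
   Context: Graphs are finite, simple and undirected. $|G|$ is the number of vertices (order) of $G$; $\log$ is base 2. A graph $G$ is $\mathcal{F}$-free if no $H\in\mathcal{F}$ is isomorphic to an induced subgraph of $G$. Delayed $\mathcal{F}$-Node-Deletion Problem: $\mathcal{F}$ is a fixed nonempty finite family of graphs such that no member is isomorphic to an induced subgraph of another, distinct member. An instance is a graph $G$ with an ordering $v_1,\dots,v_n$ of its vertices. In step $i$, vertex $v_i$ and its adjacencies to $v_1,\dots,v_{i-1}$ are revealed, and the algorithm (not knowing the future vertices or $n$) must output $S_i\subseteq\{v_1,\dots,v_i\}$ such that $G[\{v_1,\dots,v_i\}]-S_i$ is $\mathcal{F}$-free; moreover $S_1\subseteq\dots\subseteq S_n$. The goal is to minimize $|S_n|$. For an instance, $\mathrm{opt}$ is the minimum size of a set $S\subseteq V(G)$ with $G-S$ $\mathcal{F}$-free. An online algorithm with advice is deterministic, and additionally may sequentially read bits from an infinite binary tape. It is optimal if for every instance $I$ there is a tape content $\phi_I$ (chosen by an oracle knowing $I$) with which it outputs a solution of size $\mathrm{opt}(I)$ on $I$. "Any optimal online algorithm needs $b(\mathrm{opt})$ bits of advice" means: for every optimal online algorithm with advice, every choice of such tape contents $\phi_I$, and every integer $k\ge 1$, there is an instance $I$ with $\mathrm{opt}(I)=k$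 on which the algorithm, run with $\phi_I$, reads at least $b(k)$ bits of the tape. *)

theory Defs
  imports Complex_Main "HOL-Library.Stream" "Graph_Theory.Graph_Theory"
begin

text \<open>
  Finite simple undirected graphs are the symmetric loop-free finite digraphs whose arcs are pairs
  of vertices, i.e. the graphs satisfying \<^locale>\<open>pair_graph\<close>. The order of such a graph G is
  \<open>card (pverts G)\<close>.
\<close>

definition iso_to_induced_subgraph ::
    "'a pair_pre_digraph \<Rightarrow> ('v, 'e) pre_digraph \<Rightarrow> bool" where
  "iso_to_induced_subgraph H G \<longleftrightarrow>
     (\<exists>K. induced_subgraph K G \<and> digraph_iso (with_proj H) K)"

definition family_free :: "'a pair_pre_digraph set \<Rightarrow> ('v, 'e) pre_digraph \<Rightarrow> bool" where
  "family_free F G \<longleftrightarrow> (\<forall>H\<in>F. \<not> iso_to_induced_subgraph H G)"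

text \<open>The graph without vertices is neither connected nor disconnected.\<close>

definition disconnected :: "'a pair_pre_digraph \<Rightarrow> bool" where
  "disconnected G \<longleftrightarrow> pverts G \<noteq> {} \<and> \<not> Digraph_Component.connected (with_proj G)"

definition forbidden_family :: "'a pair_pre_digraph set \<Rightarrow> bool" where
  "forbidden_family F \<longleftrightarrow> F \<noteq> {} \<and> finite F \<and> (\<forall>H\<in>F. pair_graph H) \<and>
     (\<forall>H\<in>F. \<forall>H'\<in>F. H \<noteq> H' \<longrightarrow> \<not> iso_to_induced_subgraph H (with_proj H'))"


text \<open>
  An instance is a graph together with an ordering \<open>v\<^sub>1, \<dots>, v\<^sub>n\<close> of its vertices, given as a list.
\<close>

type_synonym del_instance = "nat pair_pre_digraph \<times> nat list"

definition is_instance :: "del_instance \<Rightarrow> bool" where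
  "is_instance = (\<lambda>(G, vs). pair_graph G \<and> distinct vs \<and> set vs = pverts G)"

definition del_opt :: "'a pair_pre_digraph set \<Rightarrow> del_instance \<Rightarrow> nat" where
  "del_opt F = (\<lambda>(G, vs). LEAST m. \<exists>S \<subseteq> pverts G.
     card S = m \<and> family_free F (with_proj G \<restriction> (pverts G - S)))"

text \<open>\<open>S i\<close> is the answer in step \<open>i\<close>, where steps are numbered from 1; \<open>S 0\<close> is the empty set.\<close>

definition is_solution ::
    "'a pair_pre_digraph set \<Rightarrow> del_instance \<Rightarrow> (nat \<Rightarrow> nat set) \<Rightarrow> bool" where
  "is_solution F = (\<lambda>(G, vs) S. S 0 = {} \<and>
     (\<forall>i\<in>{1..length vs}. S (i - 1) \<subseteq> S i \<and> S i \<subseteq> set (take i vs) \<and>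
        family_free F (with_proj G \<restriction> (set (take i vs) - S i))))"


text \<open>
  A revealed prefix consists of \<open>v\<^sub>1, \<dots>, v\<^sub>i\<close> in order and the graph they induce. From it and the
  list of all advice bits read so far, also those of earlier steps, the algorithm decides either to
  read the next bit of the tape or to answer the current step. Its earlier answers are determined
  by the same data and need not be passed to it.
\<close>

type_synonym revealed = "(nat, nat \<times> nat) pre_digraph \<times> nat list"

datatype action = Read | Answer "nat set"

type_synonym online_alg = "revealed \<Rightarrow> bool list \<Rightarrow> action"

type_synonym tape = "bool stream"

definition revealed_prefix :: "del_instance \<Rightarrow> nat \<Rightarrow> revealed" where
  "revealed_prefix = (\<lambda>(G, vs) i. (with_proj G \<restriction> set (take i vs), take i vs))"

text \<open>
  \<open>alg_step A t p c S d\<close>: shown the prefix \<open>p\<close> when \<open>c\<close> bits of the tape \<open>t\<close> have been read, the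
  algorithm \<open>A\<close> answers \<open>S\<close>, at which point \<open>d\<close> bits in total have been read. No such \<open>S\<close> and \<open>d\<close>
  exist if \<open>A\<close> reads forever.
\<close>

inductive alg_step ::
    "online_alg \<Rightarrow> tape \<Rightarrow> revealed \<Rightarrow> nat \<Rightarrow> nat set \<Rightarrow> nat \<Rightarrow> bool"
  for A :: online_alg and t :: tape and p :: revealed where
  answer: "A p (stake c t) = Answer S \<Longrightarrow> alg_step A t p c S c"
| read: "A p (stake c t) = Read \<Longrightarrow> alg_step A t p (Suc c) S d \<Longrightarrow> alg_step A t p c S d"

text \<open>\<open>c i\<close> is the number of bits read in the first \<open>i\<close> steps.\<close>

definition alg_run ::
    "online_alg \<Rightarrow> tape \<Rightarrow> del_instance \<Rightarrow> (nat \<Rightarrow> nat set) \<Rightarrow> (nat \<Rightarrow> nat) \<Rightarrow> bool" where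
  "alg_run A t I S c \<longleftrightarrow> S 0 = {} \<and> c 0 = 0 \<and>
     (\<forall>i\<in>{1..length (snd I)}.
        alg_step A t (revealed_prefix I i) (c (i - 1)) (S i) (c i))"

definition reads_bits :: "online_alg \<Rightarrow> tape \<Rightarrow> del_instance \<Rightarrow> nat \<Rightarrow> bool" where
  "reads_bits A t I m \<longleftrightarrow> (\<exists>S c. alg_run A t I S c \<and> m = c (length (snd I)))"

definition solves_optimally ::
    "'a pair_pre_digraph set \<Rightarrow> online_alg \<Rightarrow> tape \<Rightarrow> del_instance \<Rightarrow> bool" where
  "solves_optimally F A t I \<longleftrightarrow>
     (\<exists>S c. alg_run A t I S c \<and> is_solution F I S \<and> card (S (length (snd I))) = del_opt F I)"

definition optimal_alg :: "'a pair_pre_digraph set \<Rightarrow> online_alg \<Rightarrow> bool" where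
  "optimal_alg F A \<longleftrightarrow> (\<forall>I. is_instance I \<longrightarrow> (\<exists>t. solves_optimally F A t I))"

text \<open>Any optimal online algorithm needs \<open>b(opt)\<close> bits of advice.\<close>

definition needs_advice :: "'a pair_pre_digraph set \<Rightarrow> (nat \<Rightarrow> real) \<Rightarrow> bool" where
  "needs_advice F b \<longleftrightarrow>
     (\<forall>A \<phi>. optimal_alg F A \<longrightarrow>
        (\<forall>I. is_instance I \<longrightarrow> solves_optimally F A (\<phi> I) I) \<longrightarrow>
        (\<forall>k\<ge>1. \<exists>I. is_instance I \<and> del_opt F I = k \<and>
           (\<exists>m. reads_bits A (\<phi> I) I m \<and> b k \<le> real m)))"

end

theory Submission
  imports Defs
begin

text \<open>
  Fix a vertex \<open>f j\<close> of \<open>H\<close> for each \<open>j < k\<close>. Gadget \<open>j\<close> consists of two copies of \<open>H\<close> that share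
  \<open>f j\<close> and are otherwise completely joined to each other; the instance is the join of the \<open>k\<close>
  gadgets, and the first copies of \<open>H\<close> are revealed first. A disconnected induced subgraph of a join
  lies in one of its parts. Deleting the \<open>k\<close> shared vertices leaves a join of proper induced
  subgraphs of \<open>H\<close>, hence is a solution; and any solution that deletes just one vertex of the first
  copy in gadget \<open>j\<close> and no other vertex of the gadget must delete \<open>f j\<close>. Hence the answer given when
  the first copies are complete is forced and determines \<open>f\<close>. All these instances look the same up to
  that point, so the \<open>card (pverts H) ^ k\<close> choices of \<open>f\<close> need distinct advice by then.
\<close>

section \<open>Induced subgraphs\<close>

text \<open>Arcs of a pair graph are ordered pairs of vertices, so an isomorphism onto an induced
  subgraph is determined on arcs by its vertex map. Later arguments thus need only a vertex
  injection that preserves and reflects arcs.\<close>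

lemma iso_to_induced_subgraph_iff:
  assumes H: "pair_wf_digraph H" and G: "pair_wf_digraph G"
  shows "iso_to_induced_subgraph H (with_proj G \<restriction> X) \<longleftrightarrow>
    (\<exists>\<phi>. inj_on \<phi> (pverts H) \<and> \<phi> ` pverts H \<subseteq> X \<and>
      (\<forall>x\<in>pverts H. \<forall>y\<in>pverts H. (x, y) \<in> parcs H \<longleftrightarrow> (\<phi> x, \<phi> y) \<in> parcs G))"
    (is "?L \<longleftrightarrow> (\<exists>\<phi>. ?P \<phi>)")
proof
  assume ?L
  then obtain K h where K: "induced_subgraph K (with_proj G \<restriction> X)"
    and h: "pre_digraph.digraph_isomorphism (with_proj H) h" and Kh: "K = app_iso h (with_proj H)"
    unfolding iso_to_induced_subgraph_def digraph_iso_def by blast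
  \<comment> \<open>Compatibility with the host graph forces the tail and head maps of the image to
    be the projections.\<close>
  have V: "iso_verts h ` pverts H \<subseteq> X"
    and tl: "iso_tail h = fst" and hd: "iso_head h = snd"
    and A: "iso_arcs h ` parcs H = {e \<in> parcs G. fst e \<in> iso_verts h ` pverts H \<and>
      snd e \<in> iso_verts h ` pverts H}"
    using K unfolding Kh induced_subgraph_def subgraph_def compatible_def
    by (auto simp: induce_subgraph_def)
  have ends: "iso_arcs h a = (iso_verts h (fst a), iso_verts h (snd a))" if "a \<in> parcs H" for a
    using h that tl hd unfolding pre_digraph.digraph_isomorphism_def
    by (auto simp: prod_eq_iff)
  have inj: "inj_on (iso_verts h) (pverts H)"
    using h unfolding pre_digraph.digraph_isomorphism_def by auto
  have "(x, y) \<in> parcs H \<longleftrightarrow> (iso_verts h x, iso_verts h y) \<in> parcs G"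
    if xy: "x \<in> pverts H" "y \<in> pverts H" for x y
  proof
    assume "(x, y) \<in> parcs H"
    then have "iso_arcs h (x, y) \<in> parcs G" using A by blast
    then show "(iso_verts h x, iso_verts h y) \<in> parcs G"
      using ends[OF \<open>(x, y) \<in> parcs H\<close>] by simp
  next
    assume "(iso_verts h x, iso_verts h y) \<in> parcs G"
    then have "(iso_verts h x, iso_verts h y) \<in> iso_arcs h ` parcs H"
      unfolding A using xy by auto
    then obtain a where a: "a \<in> parcs H" "iso_arcs h a = (iso_verts h x, iso_verts h y)"
      by force
    have "fst a \<in> pverts H" "snd a \<in> pverts H"
      using a(1) pair_wf_digraph.arc_fst_in_verts[OF H] pair_wf_digraph.arc_snd_in_verts[OF H]
      by blast+
    with a ends[OF a(1)] inj xy have "a = (x, y)"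
      by (auto simp: prod_eq_iff dest: inj_onD)
    then show "(x, y) \<in> parcs H" using a by simp
  qed
  then show "\<exists>\<phi>. ?P \<phi>" using inj V by (intro exI[of _ "iso_verts h"]) blast
next
  assume "\<exists>\<phi>. ?P \<phi>"
  then obtain \<phi> where \<phi>: "?P \<phi>" ..
  define h where "h = \<lparr>iso_verts = \<phi>, iso_arcs = map_prod \<phi> \<phi>,
    iso_head = snd, iso_tail = fst\<rparr>"
  interpret H: pair_wf_digraph H by fact
  interpret G: pair_wf_digraph G by fact
  have sub: "parcs H \<subseteq> pverts H \<times> pverts H"
    using H.wellformed' by auto
  have "inj_on (map_prod \<phi> \<phi>) (pverts H \<times> pverts H)"
    using \<phi> by (auto simp: inj_on_def)
  then have inj: "inj_on (map_prod \<phi> \<phi>) (parcs H)"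
    using sub by (rule inj_on_subset)
  have arcs: "map_prod \<phi> \<phi> ` parcs H =
      {e \<in> parcs G. fst e \<in> \<phi> ` pverts H \<and> snd e \<in> \<phi> ` pverts H}"
  proof (intro equalityI subsetI)
    fix e assume "e \<in> map_prod \<phi> \<phi> ` parcs H"
    then obtain x y where "(x, y) \<in> parcs H" "e = (\<phi> x, \<phi> y)" by auto
    then show "e \<in> {e \<in> parcs G. fst e \<in> \<phi> ` pverts H \<and> snd e \<in> \<phi> ` pverts H}"
      using \<phi> sub by auto
  next
    fix e assume e: "e \<in> {e \<in> parcs G. fst e \<in> \<phi> ` pverts H \<and> snd e \<in> \<phi> ` pverts H}"
    then obtain x y where xy: "x \<in> pverts H" "y \<in> pverts H" "e = (\<phi> x, \<phi> y)"
      by (cases e) auto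
    then have "(x, y) \<in> parcs H" using \<phi> e by simp
    then show "e \<in> map_prod \<phi> \<phi> ` parcs H" using xy(3) by (metis image_eqI map_prod_simp)
  qed
  have wf: "wf_digraph (with_proj H)" by (rule H.wf_digraph)
  have iso: "pre_digraph.digraph_isomorphism (with_proj H) h"
    unfolding pre_digraph.digraph_isomorphism_def h_def using \<phi> inj wf by auto
  have wfG: "wf_digraph (with_proj G \<restriction> X)"
    by unfold_locales (auto simp: induce_subgraph_def)
  have "induced_subgraph (app_iso h (with_proj H)) (with_proj G \<restriction> X)"
    unfolding induced_subgraph_def subgraph_def compatible_def
  proof (intro conjI)
    show "verts (app_iso h (with_proj H)) \<subseteq> verts (with_proj G \<restriction> X)"
      using \<phi> by (simp add: h_def)
    have "\<phi> ` pverts H \<subseteq> X" using \<phi> by blast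
    then have "{e \<in> parcs G. fst e \<in> \<phi> ` pverts H \<and> snd e \<in> \<phi> ` pverts H} =
        {e \<in> arcs (with_proj G \<restriction> X). fst e \<in> \<phi> ` pverts H \<and> snd e \<in> \<phi> ` pverts H}"
      by (auto simp: induce_subgraph_def)
    with arcs have arcs': "map_prod \<phi> \<phi> ` parcs H =
        {e \<in> arcs (with_proj G \<restriction> X). fst e \<in> \<phi> ` pverts H \<and> snd e \<in> \<phi> ` pverts H}"
      by simp
    then have "map_prod \<phi> \<phi> ` parcs H \<subseteq> arcs (with_proj G \<restriction> X)" by blast
    then show "arcs (app_iso h (with_proj H)) \<subseteq> arcs (with_proj G \<restriction> X)"
      by (simp add: h_def)
    show "arcs (app_iso h (with_proj H)) = {e \<in> arcs (with_proj G \<restriction> X).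
        tail (with_proj G \<restriction> X) e \<in> verts (app_iso h (with_proj H)) \<and>
        head (with_proj G \<restriction> X) e \<in> verts (app_iso h (with_proj H))}"
      using arcs' by (simp add: h_def induce_subgraph_def)
    show "wf_digraph (with_proj G \<restriction> X)" by fact
    show "wf_digraph (app_iso h (with_proj H))" by (rule wf_digraph.wf_digraphI_app_iso[OF wf iso])
  qed (simp_all add: h_def induce_subgraph_def)
  with iso show ?L
    unfolding iso_to_induced_subgraph_def digraph_iso_def by blast
qed

lemma iso_to_induced_subgraph_whole_iff:
  assumes "pair_wf_digraph H" and G: "pair_wf_digraph G"
  shows "iso_to_induced_subgraph H (with_proj G) \<longleftrightarrow>
    (\<exists>\<phi>. inj_on \<phi> (pverts H) \<and> \<phi> ` pverts H \<subseteq> pverts G \<and>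
      (\<forall>x\<in>pverts H. \<forall>y\<in>pverts H. (x, y) \<in> parcs H \<longleftrightarrow> (\<phi> x, \<phi> y) \<in> parcs G))"
proof -
  interpret G: pair_wf_digraph G by fact
  have "with_proj G \<restriction> pverts G = with_proj G"
    by (auto simp: induce_subgraph_def with_proj_def G.wellformed')
  then show ?thesis
    using iso_to_induced_subgraph_iff[OF assms, of "pverts G"] by simp
qed

text \<open>The labels name the parts of a join: vertices in different parts are adjacent.\<close>

lemma disconnected_same_part:
  assumes G: "pair_graph G" and d: "disconnected G"
    and join: "\<And>x y. x \<in> pverts G \<Longrightarrow> y \<in> pverts G \<Longrightarrow> q x \<noteq> q y \<Longrightarrow> (x, y) \<in> parcs G"
  shows "\<exists>c. \<forall>x\<in>pverts G. q x = c"
proof (rule ccontr)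
  assume "\<nexists>c. \<forall>x\<in>pverts G. q x = c"
  then have other: "\<exists>y\<in>pverts G. q y \<noteq> c" for c by blast
  interpret G: pair_graph G by fact
  have "u \<rightarrow>\<^sup>*\<^bsub>with_proj G\<^esub> v" if uv: "u \<in> pverts G" "v \<in> pverts G" for u v
  proof (cases "q u = q v")
    case True
    \<comment> \<open>Two vertices of one part are linked through any vertex of another
      part.\<close>
    obtain w where w: "w \<in> pverts G" "q w \<noteq> q u" using other by blast
    then have "(u, w) \<in> parcs G" "(w, v) \<in> parcs G" using join uv True by metis+
    then have "u \<rightarrow>\<^sup>*\<^bsub>with_proj G\<^esub> w" "w \<rightarrow>\<^sup>*\<^bsub>with_proj G\<^esub> v"
      by (auto intro!: G.reachable_adjI)
    then show ?thesis by (rule G.reachable_trans)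
  next
    case False
    then show ?thesis using join uv by (auto intro!: G.reachable_adjI)
  qed
  then have "Digraph_Component.connected (with_proj G)"
    using d by (intro G.connectedI G.reachable_mk_symmetricI) (auto simp: disconnected_def)
  then show False using d by (simp add: disconnected_def)
qed

section \<open>Runs of online algorithms\<close>

lemma alg_step_le: "alg_step A t p c S d \<Longrightarrow> c \<le> d"
  by (induction rule: alg_step.induct) auto

lemma alg_step_unique:
  assumes "alg_step A t p c S d" "alg_step A t p c S' d'"
  shows "S' = S \<and> d' = d"
  using assms
proof (induction rule: alg_step.induct)
  case (answer c S)
  then show ?case by (auto elim: alg_step.cases)
next
  case (read c S d)
  from read.prems read.hyps(1) have "alg_step A t p (Suc c) S' d'"
    by (auto elim: alg_step.cases)
  then show ?case by (rule read.IH)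
qed

lemma stake_eq_mono: "stake n s = stake n t \<Longrightarrow> m \<le> n \<Longrightarrow> stake m s = stake m t"
  by (metis min.absorb1 take_stake)

text \<open>A step ending at tape position \<open>d\<close> consults only the first \<open>d\<close>
  bits, so the rest of the tape cannot influence it.\<close>

lemma alg_step_cong_tape:
  assumes "alg_step A t p c S d" "stake d t = stake d t'"
  shows "alg_step A t' p c S d"
  using assms
proof (induction rule: alg_step.induct)
  case (answer c S)
  then show ?case by (auto intro: alg_step.answer)
next
  case (read c S d)
  have "c \<le> d" using alg_step_le[OF read.hyps(2)] by simp
  then have "stake c t = stake c t'" using read.prems stake_eq_mono by blast
  with read show ?case by (auto intro: alg_step.read)
qed

lemma alg_run_step:
  assumes "alg_run A t I S c" "i < length (snd I)"
  shows "alg_step A t (revealed_prefix I (Suc i)) (c i) (S (Suc i)) (c (Suc i))"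
proof -
  have "Suc i \<in> {1..length (snd I)}" using assms(2) by simp
  then show ?thesis using assms(1) unfolding alg_run_def by (metis diff_Suc_1)
qed

lemma alg_run_mono:
  assumes run: "alg_run A t I S c" and "i \<le> n" "n \<le> length (snd I)"
  shows "c i \<le> c n"
  using assms(2,3)
proof (induction n rule: dec_induct)
  case base
  then show ?case by simp
next
  case (step n)
  have "alg_step A t (revealed_prefix I (Suc n)) (c n) (S (Suc n)) (c (Suc n))"
    using alg_run_step[OF run] step by simp
  then show ?case using alg_step_le step by fastforce
qed

text \<open>A deterministic algorithm can tell two instances apart only by what is revealed or by
  the advice. Agreement of the tapes up to the bit count of the first run suffices, since the second
  run turns out to read equally many bits.\<close>

lemma alg_run_same_prefix:
  assumes run: "alg_run A t I S c" and run': "alg_run A t' I' S' c'"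
    and n: "n \<le> length (snd I)" "n \<le> length (snd I')"
    and pre: "\<And>i. i \<le> n \<Longrightarrow> revealed_prefix I i = revealed_prefix I' i"
    and tape: "stake (c n) t = stake (c n) t'"
  shows "S n = S' n"
proof -
  \<comment> \<open>The bit counts belong in the induction, as they fix the tape position at which
    the next step starts.\<close>
  have "S i = S' i \<and> c i = c' i" if "i \<le> n" for i
    using that
  proof (induction i)
    case 0
    then show ?case using run run' by (simp add: alg_run_def)
  next
    case (Suc i)
    have s: "alg_step A t (revealed_prefix I (Suc i)) (c i) (S (Suc i)) (c (Suc i))"
      using alg_run_step[OF run] Suc.prems n by simp
    have s': "alg_step A t' (revealed_prefix I' (Suc i)) (c' i) (S' (Suc i)) (c' (Suc i))"
      using alg_run_step[OF run'] Suc.prems n by simp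
    have "c (Suc i) \<le> c n" using alg_run_mono[OF run Suc.prems n(1)] .
    with tape have "stake (c (Suc i)) t = stake (c (Suc i)) t'" by (rule stake_eq_mono)
    from alg_step_cong_tape[OF s this] s' show ?case
      using alg_step_unique pre[OF Suc.prems] Suc by (metis Suc_leD)
  qed
  then show ?thesis by simp
qed

lemma is_solution_mono:
  assumes "is_solution F I S" "i \<le> n" "n \<le> length (snd I)"
  shows "S i \<subseteq> S n"
  using assms(2,3)
proof (induction n rule: dec_induct)
  case (step n)
  have "S n \<subseteq> S (Suc n)" using assms(1) step
    unfolding is_solution_def by (auto simp: split_beta) force
  then show ?case using step by fastforce
qed simp

text \<open>
  If all the lengths were below \<open>log 2 (card P)\<close>, the initial bits up to the largest length would
  have to distinguish more elements than there are bit strings of that length.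
\<close>

lemma ex_long_advice:
  fixes t :: "'i \<Rightarrow> bool stream" and m :: "'i \<Rightarrow> nat"
  assumes P: "finite P" "P \<noteq> {}"
    and sep: "\<And>f f'. f \<in> P \<Longrightarrow> f' \<in> P \<Longrightarrow> stake (m f) (t f) = stake (m f) (t f') \<Longrightarrow> f = f'"
  shows "\<exists>f\<in>P. card P \<le> 2 ^ m f"
proof -
  have "Max (m ` P) \<in> m ` P" using P by simp
  then obtain f where f: "f \<in> P" "m f = Max (m ` P)" by auto
  have "inj_on (\<lambda>f'. stake (m f) (t f')) P"
  proof (rule inj_onI)
    fix a b assume ab: "a \<in> P" "b \<in> P" "stake (m f) (t a) = stake (m f) (t b)"
    \<comment> \<open>Agreement on the longest prefix implies agreement on the first
      \<open>m a\<close> bits, which is what \<open>sep\<close> asks for.\<close>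
    have "m a \<le> m f" using f(2) ab(1) P by simp
    then show "a = b" using sep ab stake_eq_mono by blast
  qed
  moreover have "(\<lambda>f'. stake (m f) (t f')) ` P \<subseteq> {bs. set bs \<subseteq> (UNIV :: bool set) \<and> length bs = m f}"
    by auto
  ultimately have "card P \<le> card {bs. set bs \<subseteq> (UNIV :: bool set) \<and> length bs = m f}"
    using card_inj_on_le[OF _ _ finite_lists_length_eq[OF finite_UNIV]] by blast
  also have "\<dots> = 2 ^ m f"
    by (subst card_lists_length_eq) simp_all
  finally show ?thesis using f(1) by blast
qed

section \<open>The instances\<close>

text \<open>Vertices of instances are natural numbers, so \<open>g\<close> numbers the vertices of
  \<open>H\<close>. The choice \<open>f\<close> of shared vertices is no parameter of the locale,
  because instances for different \<open>f\<close> are compared.\<close>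

locale join_of_gadgets =
  fixes H :: "'a pair_pre_digraph" and g :: "'a \<Rightarrow> nat" and k :: nat
  assumes H_graph: "pair_graph H" and g_inj: "inj_on g (pverts H)"
begin

sublocale H: pair_graph H by (rule H_graph)

text \<open>
  The triple \<open>(j, b, x)\<close> is the vertex \<open>x\<close> in the first (\<open>\<not> b\<close>) or second (\<open>b\<close>) copy of \<open>H\<close> in
  gadget \<open>j\<close>; the shared vertex is \<open>(j, False, f j)\<close>.
\<close>

definition enc :: "nat \<times> bool \<times> 'a \<Rightarrow> nat" where
  "enc = (\<lambda>(j, b, x). to_nat (j, b, g x))"

definition nodes :: "(nat \<Rightarrow> 'a) \<Rightarrow> (nat \<times> bool \<times> 'a) set" where
  "nodes f = {(j, b, x). j < k \<and> x \<in> pverts H \<and> (b \<longrightarrow> x \<noteq> f j)}"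

definition base :: "(nat \<times> bool \<times> 'a) set" where
  "base = {..<k} \<times> {False} \<times> pverts H"

text \<open>Adjacency follows \<open>H\<close> within each copy and at the shared vertex; the
  implication makes all other pairs adjacent. Since the second copy omits \<open>f j\<close>, the
  test \<open>x = f j\<close> singles out the shared vertex among \<open>nodes f\<close>.\<close>

definition adj :: "(nat \<Rightarrow> 'a) \<Rightarrow> nat \<times> bool \<times> 'a \<Rightarrow> nat \<times> bool \<times> 'a \<Rightarrow> bool" where
  "adj f = (\<lambda>(j, b, x) (j', b', x'). j = j' \<and> (b = b' \<or> x = f j \<or> x' = f j) \<longrightarrow> (x, x') \<in> parcs H)"

definition gadget_graph :: "(nat \<Rightarrow> 'a) \<Rightarrow> nat pair_pre_digraph" where
  "gadget_graph f = \<lparr>pverts = enc ` nodes f,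
     parcs = {(enc u, enc v) | u v. u \<in> nodes f \<and> v \<in> nodes f \<and> adj f u v}\<rparr>"

text \<open>Sorting makes the order within the first block depend on the set \<open>base\<close>
  only, hence not on \<open>f\<close>.\<close>

definition gadget_instance :: "(nat \<Rightarrow> 'a) \<Rightarrow> del_instance" where
  "gadget_instance f = (gadget_graph f,
     sorted_list_of_set (enc ` base) @ sorted_list_of_set (enc ` (nodes f - base)))"

definition shared :: "(nat \<Rightarrow> 'a) \<Rightarrow> nat set" where
  "shared f = (\<lambda>j. enc (j, False, f j)) ` {..<k}"

lemma enc_eq_iff:
  "x \<in> pverts H \<Longrightarrow> y \<in> pverts H \<Longrightarrow> enc (j, b, x) = enc (j', b', y) \<longleftrightarrow> j = j' \<and> b = b' \<and> x = y"
  using g_inj by (auto simp: enc_def dest: inj_onD)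

lemma enc_inj: "inj_on enc (nodes f)"
  by (auto simp: inj_on_def nodes_def enc_eq_iff)

lemma base_subset: "base \<subseteq> nodes f"
  by (auto simp: base_def nodes_def)

lemma finite_nodes: "finite (nodes f)"
  by (rule finite_subset[of _ "{..<k} \<times> UNIV \<times> pverts H"])
    (auto simp: nodes_def H.pair_finite_verts)

lemma finite_base: "finite base"
  by (simp add: base_def H.pair_finite_verts)

lemma parcs_gadget_graph:
  assumes "u \<in> nodes f" "v \<in> nodes f"
  shows "(enc u, enc v) \<in> parcs (gadget_graph f) \<longleftrightarrow> adj f u v"
proof
  assume "(enc u, enc v) \<in> parcs (gadget_graph f)"
  then obtain u' v' where "enc u = enc u'" "enc v = enc v'" "u' \<in> nodes f" "v' \<in> nodes f" "adj f u' v'"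
    unfolding gadget_graph_def pair_pre_digraph.simps by blast
  moreover from this have "u' = u" "v' = v" using assms inj_onD[OF enc_inj[of f]] by metis+
  ultimately show "adj f u v" by simp
next
  assume "adj f u v"
  then show "(enc u, enc v) \<in> parcs (gadget_graph f)"
    using assms unfolding gadget_graph_def pair_pre_digraph.simps by blast
qed

lemma adj_sym: "adj f u v \<Longrightarrow> adj f v u"
  using H.graph_symmetric by (auto simp: adj_def split: prod.splits)

lemma adj_irrefl: "\<not> adj f u u"
proof -
  have "(x, x) \<notin> parcs H" for x using H.pair_no_loops[of "(x, x)"] by auto
  then show ?thesis by (simp add: adj_def split: prod.split)
qed

lemma pair_graph_gadget_graph: "pair_graph (gadget_graph f)"
proof
  have "parcs (gadget_graph f) \<subseteq> enc ` nodes f \<times> enc ` nodes f"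
    by (auto simp: gadget_graph_def)
  then show "finite (parcs (gadget_graph f))"
    using finite_nodes finite_subset by blast
  show "finite (pverts (gadget_graph f))"
    by (simp add: gadget_graph_def finite_nodes)
  show "symmetric (with_proj (gadget_graph f))"
    by (simp add: symmetric_def sym_def gadget_graph_def) (blast intro: adj_sym)
  show "fst e \<noteq> snd e" if e: "e \<in> parcs (gadget_graph f)" for e
  proof -
    obtain u v where uv: "e = (enc u, enc v)" "u \<in> nodes f" "v \<in> nodes f" "adj f u v"
      using e unfolding gadget_graph_def pair_pre_digraph.simps by blast
    then have "u \<noteq> v" using adj_irrefl by blast
    then show ?thesis using uv inj_onD[OF enc_inj[of f], of u v] by auto
  qed
qed (auto simp: gadget_graph_def)

lemma pair_wf_gadget_graph: "pair_wf_digraph (gadget_graph f)"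
  using pair_graph_gadget_graph by (simp add: pair_graph_def pair_digraph_def pair_fin_digraph_def)

lemma is_instance_gadget_instance: "is_instance (gadget_instance f)"
  using pair_graph_gadget_graph[of f] finite_nodes[of f] finite_base base_subset[of f] enc_inj[of f]
  by (auto simp: is_instance_def gadget_instance_def gadget_graph_def dest: inj_onD)

lemma set_gadget_instance: "set (snd (gadget_instance f)) = enc ` nodes f"
  using is_instance_gadget_instance[of f]
  by (simp add: is_instance_def gadget_instance_def gadget_graph_def)

lemma length_base_le: "card (enc ` base) \<le> length (snd (gadget_instance f))"
  by (simp add: gadget_instance_def)

lemma take_base:
  assumes "i \<le> card (enc ` base)"
  shows "take i (snd (gadget_instance f)) = take i (sorted_list_of_set (enc ` base))"
  using assms by (simp add: gadget_instance_def)

lemma set_take_base: "set (take (card (enc ` base)) (snd (gadget_instance f))) = enc ` base"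
  by (simp add: take_base finite_base)

text \<open>Within \<open>base\<close> all copy flags are \<open>False\<close>, so the clauses of
  \<open>adj\<close> that mention \<open>f\<close> have no effect.\<close>

lemma parcs_base_eq:
  assumes "u \<in> base" "v \<in> base"
  shows "(enc u, enc v) \<in> parcs (gadget_graph f) \<longleftrightarrow> (enc u, enc v) \<in> parcs (gadget_graph f')"
  using assms base_subset[of f] base_subset[of f']
  by (subst (1 2) parcs_gadget_graph) (auto simp: adj_def base_def)

lemma revealed_prefix_base:
  assumes "i \<le> card (enc ` base)"
  shows "revealed_prefix (gadget_instance f) i = revealed_prefix (gadget_instance f') i"
proof -
  let ?L = "take i (sorted_list_of_set (enc ` base))"
  have sub: "set ?L \<subseteq> enc ` base"
    using set_take_subset[of i "sorted_list_of_set (enc ` base)"] finite_base by simp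
  have arc_iff: "e \<in> parcs (gadget_graph f) \<longleftrightarrow> e \<in> parcs (gadget_graph f')"
    if e: "fst e \<in> set ?L" "snd e \<in> set ?L" for e
  proof -
    obtain u v where uv: "u \<in> base" "v \<in> base" "fst e = enc u" "snd e = enc v"
      using subsetD[OF sub e(1)] subsetD[OF sub e(2)] by (elim imageE) simp
    then have "e = (enc u, enc v)" by (simp add: prod_eq_iff)
    then show ?thesis using parcs_base_eq[OF uv(1,2)] by simp
  qed
  have "{e \<in> parcs (gadget_graph f). fst e \<in> set ?L \<and> snd e \<in> set ?L} =
      {e \<in> parcs (gadget_graph f'). fst e \<in> set ?L \<and> snd e \<in> set ?L}"
    by (rule Collect_cong) (use arc_iff in blast)
  then show ?thesis
    using assms by (simp add: revealed_prefix_def gadget_instance_def induce_subgraph_def)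
qed

lemma card_shared:
  assumes "f \<in> {..<k} \<rightarrow> pverts H"
  shows "card (shared f) = k"
proof -
  have "inj_on (\<lambda>j. enc (j, False, f j)) {..<k}"
    using assms by (intro inj_onI) (auto simp: enc_eq_iff Pi_iff)
  then show ?thesis by (simp add: shared_def card_image)
qed

text \<open>The gadget index is part of the encoding, so the set reveals the value of
  \<open>f\<close> in each gadget; extensionality fixes the other values.\<close>

lemma shared_inj:
  assumes "f \<in> {..<k} \<rightarrow>\<^sub>E pverts H" "f' \<in> {..<k} \<rightarrow>\<^sub>E pverts H" "shared f = shared f'"
  shows "f = f'"
proof (rule PiE_ext[OF assms(1,2)])
  fix j assume j: "j \<in> {..<k}"
  then have "enc (j, False, f j) \<in> shared f'" using assms(3) by (auto simp: shared_def)
  then obtain j' where "j' < k" "enc (j, False, f j) = enc (j', False, f' j')"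
    by (auto simp: shared_def)
  then show "f j = f' j"
    using assms(1,2) j by (subst (asm) enc_eq_iff) (auto simp: PiE_iff)
qed

end

section \<open>Solutions of the gadget instances\<close>

locale hard_family = join_of_gadgets H g k
  for F :: "'a pair_pre_digraph set" and H :: "'a pair_pre_digraph" and g :: "'a \<Rightarrow> nat" and k :: nat +
  assumes F: "forbidden_family F" and disc: "\<And>G. G \<in> F \<Longrightarrow> disconnected G" and H_in: "H \<in> F"
begin

lemma pair_graph_F: "G \<in> F \<Longrightarrow> pair_graph G"
  using F by (simp add: forbidden_family_def)

lemma pair_wf_F: "G \<in> F \<Longrightarrow> pair_wf_digraph G"
  using pair_graph_F by (auto simp: pair_graph_def pair_digraph_def pair_fin_digraph_def)

text \<open>For \<open>G = H\<close> there are too few vertices; for any other \<open>G\<close> the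
  embedding would contradict that no member of \<open>F\<close> is induced in another.\<close>

lemma no_embedding_minus_vertex:
  assumes G: "G \<in> F" and v: "v \<in> pverts H"
    and inj: "inj_on \<psi> (pverts G)" and im: "\<psi> ` pverts G \<subseteq> pverts H - {v}"
    and arcs: "\<And>x y. x \<in> pverts G \<Longrightarrow> y \<in> pverts G \<Longrightarrow> (x, y) \<in> parcs G \<longleftrightarrow> (\<psi> x, \<psi> y) \<in> parcs H"
  shows False
proof (cases "G = H")
  case True
  then have "card (pverts H) \<le> card (pverts H - {v})"
    using inj im H.pair_finite_verts by (metis card_inj_on_le finite_Diff)
  then show False using v H.pair_finite_verts by (metis card_Diff1_less not_less)
next
  case False
  have "iso_to_induced_subgraph G (with_proj H)"
    unfolding iso_to_induced_subgraph_whole_iff[OF pair_wf_F[OF G] pair_wf_F[OF H_in]]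
    using inj im arcs by blast
  then show False using F G H_in False by (auto simp: forbidden_family_def)
qed

text \<open>Once the shared vertices are gone, the graph is a join whose parts are the single
  copies, each of them \<open>H\<close> without one vertex. A disconnected forbidden graph would
  have to fit into one part.\<close>

lemma family_free_minus_shared:
  assumes f: "f \<in> {..<k} \<rightarrow> pverts H"
  shows "family_free F (with_proj (gadget_graph f) \<restriction> (enc ` nodes f - shared f))"
  unfolding family_free_def
proof (intro ballI notI)
  fix G assume G: "G \<in> F"
    and iso: "iso_to_induced_subgraph G (with_proj (gadget_graph f) \<restriction> (enc ` nodes f - shared f))"
  from iso[unfolded iso_to_induced_subgraph_iff[OF pair_wf_F[OF G] pair_wf_gadget_graph]]
  obtain \<phi> where inj: "inj_on \<phi> (pverts G)"
    and im: "\<phi> ` pverts G \<subseteq> enc ` nodes f - shared f"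
    and arcs: "\<And>x y. x \<in> pverts G \<Longrightarrow> y \<in> pverts G \<Longrightarrow>
      (x, y) \<in> parcs G \<longleftrightarrow> (\<phi> x, \<phi> y) \<in> parcs (gadget_graph f)"
    by (elim exE conjE) simp
  have "\<exists>u. \<forall>x\<in>pverts G. u x \<in> nodes f \<and> \<phi> x = enc (u x)"
    using im by (intro bchoice) blast
  then obtain u where u: "\<And>x. x \<in> pverts G \<Longrightarrow> u x \<in> nodes f"
      "\<And>x. x \<in> pverts G \<Longrightarrow> \<phi> x = enc (u x)"
    by blast
  \<comment> \<open>\<open>q\<close> names the part (gadget and copy), \<open>\<psi>\<close> the
    corresponding vertex of \<open>H\<close>.\<close>
  define q where "q x = (fst (u x), fst (snd (u x)))" for x
  define \<psi> where "\<psi> x = snd (snd (u x))" for x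
  have u_eq: "u x = (fst (q x), snd (q x), \<psi> x)" for x by (simp add: q_def \<psi>_def)
  have arcs': "(x, y) \<in> parcs G \<longleftrightarrow> adj f (u x) (u y)" if "x \<in> pverts G" "y \<in> pverts G" for x y
    using arcs[OF that] that u parcs_gadget_graph by simp
  have avoid: "\<psi> x \<in> pverts H \<and> \<psi> x \<noteq> f (fst (q x)) \<and> fst (q x) < k" if x: "x \<in> pverts G" for x
  proof -
    have n: "(fst (q x), snd (q x), \<psi> x) \<in> nodes f" using u(1)[OF x] u_eq by metis
    moreover have "\<not> snd (q x) \<Longrightarrow> \<psi> x \<noteq> f (fst (q x))"
    proof
      assume "\<not> snd (q x)" "\<psi> x = f (fst (q x))"
      then have "\<phi> x = enc (fst (q x), False, f (fst (q x)))" using u(2)[OF x] u_eq[of x] by simp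
      then have "\<phi> x \<in> shared f" using n by (auto simp: shared_def nodes_def)
      then show False using im x by blast
    qed
    ultimately show ?thesis by (auto simp: nodes_def)
  qed
  \<comment> \<open>By \<open>avoid\<close> neither vertex is shared, so the premise in
    \<open>adj\<close> fails for different parts.\<close>
  have "(x, y) \<in> parcs G" if "x \<in> pverts G" "y \<in> pverts G" "q x \<noteq> q y" for x y
    using avoid[OF that(1)] avoid[OF that(2)] that
    unfolding arcs'[OF that(1,2)] u_eq by (auto simp: adj_def prod_eq_iff)
  then obtain c where c: "\<And>x. x \<in> pverts G \<Longrightarrow> q x = c"
    using disconnected_same_part[OF pair_graph_F[OF G] disc[OF G]] by metis
  \<comment> \<open>A vertex of \<open>G\<close> is needed to see that the part \<open>c\<close>
    belongs to an actual gadget.\<close>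
  have "pverts G \<noteq> {}" using disc[OF G] by (simp add: disconnected_def)
  then have "fst c < k" using avoid c by fastforce
  then have v: "f (fst c) \<in> pverts H" using f by auto
  show False
  proof (rule no_embedding_minus_vertex[OF G v, of \<psi>])
    show "inj_on \<psi> (pverts G)"
    proof (rule inj_onI)
      fix x y assume xy: "x \<in> pverts G" "y \<in> pverts G" "\<psi> x = \<psi> y"
      then have "u x = u y" using u_eq c by metis
      then show "x = y" using u(2) inj xy by (metis inj_onD)
    qed
    show "\<psi> ` pverts G \<subseteq> pverts H - {f (fst c)}" using avoid c by auto
    show "(x, y) \<in> parcs G \<longleftrightarrow> (\<psi> x, \<psi> y) \<in> parcs H" if "x \<in> pverts G" "y \<in> pverts G" for x y
      unfolding arcs'[OF that] u_eq using c that by (auto simp: adj_def)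
  qed
qed

text \<open>The first copy is an induced \<open>H\<close>. Leaving \<open>X\<close> general covers
  both the moment when the first copies are complete and the final graph.\<close>

lemma hits_first_copy:
  assumes free: "family_free F (with_proj (gadget_graph f) \<restriction> (X - S))"
    and X: "enc ` base \<subseteq> X" and j: "j < k"
  shows "\<exists>x\<in>pverts H. enc (j, False, x) \<in> S"
proof (rule ccontr)
  assume no: "\<not> ?thesis"
  let ?\<phi> = "\<lambda>x. enc (j, False, x)"
  have "?\<phi> ` pverts H \<subseteq> X - S" using no X j by (auto simp: base_def)
  moreover have "inj_on ?\<phi> (pverts H)" by (auto simp: inj_on_def enc_eq_iff)
  moreover have "(x, y) \<in> parcs H \<longleftrightarrow> (?\<phi> x, ?\<phi> y) \<in> parcs (gadget_graph f)"
    if "x \<in> pverts H" "y \<in> pverts H" for x y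
    using that j by (subst parcs_gadget_graph) (auto simp: nodes_def adj_def)
  ultimately have "iso_to_induced_subgraph H (with_proj (gadget_graph f) \<restriction> (X - S))"
    unfolding iso_to_induced_subgraph_iff[OF pair_wf_F[OF H_in] pair_wf_gadget_graph] by blast
  then show False using free H_in by (auto simp: family_free_def)
qed

text \<open>The flag \<open>x \<noteq> f j\<close> describes the second copy of \<open>H\<close>
  with its missing vertex supplied by the shared one; this is again an induced
  \<open>H\<close>.\<close>

lemma hits_second_copy:
  assumes f: "f \<in> {..<k} \<rightarrow> pverts H"
    and free: "family_free F (with_proj (gadget_graph f) \<restriction> (enc ` nodes f - S))" and j: "j < k"
  shows "\<exists>x\<in>pverts H. enc (j, x \<noteq> f j, x) \<in> S"
proof (rule ccontr)
  assume no: "\<not> ?thesis"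
  let ?\<phi> = "\<lambda>x. enc (j, x \<noteq> f j, x)"
  have n: "(j, x \<noteq> f j, x) \<in> nodes f" if "x \<in> pverts H" for x
    using that j by (auto simp: nodes_def)
  have "?\<phi> ` pverts H \<subseteq> enc ` nodes f - S" using no n by blast
  moreover have "inj_on ?\<phi> (pverts H)" by (auto simp: inj_on_def enc_eq_iff)
  moreover have "(x, y) \<in> parcs H \<longleftrightarrow> (?\<phi> x, ?\<phi> y) \<in> parcs (gadget_graph f)"
    if "x \<in> pverts H" "y \<in> pverts H" for x y
    using parcs_gadget_graph[OF n[OF that(1)] n[OF that(2)]] by (auto simp: adj_def)
  ultimately have "iso_to_induced_subgraph H (with_proj (gadget_graph f) \<restriction> (enc ` nodes f - S))"
    unfolding iso_to_induced_subgraph_iff[OF pair_wf_F[OF H_in] pair_wf_gadget_graph] by blast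
  then show False using free H_in by (auto simp: family_free_def)
qed

text \<open>One deleted vertex per gadget is again a choice function, so \<open>shared w\<close>
  serves as notation for an arbitrary transversal of the first copies.\<close>

lemma first_copy_transversal:
  assumes free: "family_free F (with_proj (gadget_graph f) \<restriction> (X - S))" and X: "enc ` base \<subseteq> X"
  obtains w where "w \<in> {..<k} \<rightarrow> pverts H" "shared w \<subseteq> S"
proof -
  have "\<exists>w. \<forall>j\<in>{..<k}. w j \<in> pverts H \<and> enc (j, False, w j) \<in> S"
    using hits_first_copy[OF free X] by (intro bchoice) blast
  then show thesis using that by (auto simp: shared_def)
qed

lemma del_opt_gadget_instance:
  assumes f: "f \<in> {..<k} \<rightarrow> pverts H"
  shows "del_opt F (gadget_instance f) = k"
proof -
  have V: "pverts (gadget_graph f) = enc ` nodes f" by (simp add: gadget_graph_def)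
  have "(LEAST m. \<exists>S \<subseteq> enc ` nodes f. card S = m \<and>
      family_free F (with_proj (gadget_graph f) \<restriction> (enc ` nodes f - S))) = k"
  proof (rule Least_equality)
    have "shared f \<subseteq> enc ` nodes f" using f by (auto simp: shared_def nodes_def)
    then show "\<exists>S \<subseteq> enc ` nodes f. card S = k \<and>
        family_free F (with_proj (gadget_graph f) \<restriction> (enc ` nodes f - S))"
      using card_shared[OF f] family_free_minus_shared[OF f] by blast
  next
    fix m assume "\<exists>S \<subseteq> enc ` nodes f. card S = m \<and>
        family_free F (with_proj (gadget_graph f) \<restriction> (enc ` nodes f - S))"
    then obtain S where S: "S \<subseteq> enc ` nodes f" "card S = m"
      and free: "family_free F (with_proj (gadget_graph f) \<restriction> (enc ` nodes f - S))" by blast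
    obtain w where "w \<in> {..<k} \<rightarrow> pverts H" "shared w \<subseteq> S"
      using first_copy_transversal[OF free image_mono[OF base_subset]] .
    moreover have "finite S" using S(1) finite_nodes finite_subset by blast
    ultimately show "k \<le> m" using card_shared card_mono S(2) by metis
  qed
  then show ?thesis by (simp add: del_opt_def gadget_instance_def V)
qed

lemma forced_answer:
  assumes f: "f \<in> {..<k} \<rightarrow> pverts H"
    and sol: "is_solution F (gadget_instance f) S"
    and opt: "card (S (length (snd (gadget_instance f)))) = k"
  shows "S (card (enc ` base)) = shared f"
proof (cases "k = 0")
  case True
  \<comment> \<open>Without gadgets the step in question is step 0, whose answer is empty by
    convention.\<close>
  then have "base = {}" "shared f = {}" unfolding base_def shared_def by simp_all
  then show ?thesis using sol by (simp add: is_solution_def split_beta)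
next
  case False
  let ?I = "gadget_instance f" and ?n = "card (enc ` base)"
  let ?N = "length (snd ?I)"
  have "pverts H \<noteq> {}" using disc[OF H_in] by (simp add: disconnected_def)
  then have "base \<noteq> {}" using False by (auto simp: base_def)
  then have n: "1 \<le> ?n" using finite_base by (simp add: Suc_le_eq card_gt_0_iff)
  have N: "?n \<le> ?N" by (rule length_base_le)
  have step: "S i \<subseteq> set (take i (snd ?I)) \<and>
      family_free F (with_proj (gadget_graph f) \<restriction> (set (take i (snd ?I)) - S i))"
    if "1 \<le> i" "i \<le> ?N" for i
    using sol that by (simp add: is_solution_def split_beta gadget_instance_def)
  have free_n: "family_free F (with_proj (gadget_graph f) \<restriction> (enc ` base - S ?n))"
    using step[OF n N] by (simp add: set_take_base)
  have SN: "S ?N \<subseteq> enc ` nodes f"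
    and free_N: "family_free F (with_proj (gadget_graph f) \<restriction> (enc ` nodes f - S ?N))"
    using step[of ?N] n N by (simp_all add: set_gadget_instance)
  obtain w where w: "w \<in> {..<k} \<rightarrow> pverts H" "shared w \<subseteq> S ?n"
    using first_copy_transversal[OF free_n] by blast
  have mono: "S ?n \<subseteq> S ?N" using is_solution_mono[OF sol N] by simp
  have "finite (S ?N)" using SN finite_nodes finite_subset by blast
  \<comment> \<open>The \<open>k\<close> vertices deleted early already exhaust the budget, so
    nothing is deleted before or after besides \<open>shared w\<close>.\<close>
  then have "shared w = S ?N"
    using w mono opt card_shared[OF w(1)] by (intro card_subset_eq) auto
  then have S: "S ?n = shared w" "S ?N = shared w" using w(2) mono by auto
  have "w j = f j" if j: "j < k" for j
  proof -
    \<comment> \<open>Members of \<open>shared w\<close> carry the flag \<open>False\<close>, so the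
      vertex hit in the second copy must be the shared one.\<close>
    obtain x where x: "x \<in> pverts H" "enc (j, x \<noteq> f j, x) \<in> shared w"
      using hits_second_copy[OF f free_N j] S by auto
    then obtain i where i: "i < k" "enc (j, x \<noteq> f j, x) = enc (i, False, w i)"
      by (auto simp: shared_def)
    moreover have "w i \<in> pverts H" using w(1) i(1) by auto
    ultimately show ?thesis using x(1) by (auto simp: enc_eq_iff)
  qed
  then show ?thesis unfolding S by (auto simp: shared_def)
qed

section \<open>Counting the advice strings\<close>

lemma ex_instance_many_bits:
  assumes solves: "\<And>I. is_instance I \<Longrightarrow> solves_optimally F A (\<phi> I) I"
  shows "\<exists>I. is_instance I \<and> del_opt F I = k \<and>
    (\<exists>m. reads_bits A (\<phi> I) I m \<and> card (pverts H) ^ k \<le> 2 ^ m)"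
proof -
  let ?P = "{..<k} \<rightarrow>\<^sub>E pverts H" and ?I = gadget_instance and ?n = "card (enc ` base)"
  have "\<forall>f. \<exists>S c. alg_run A (\<phi> (?I f)) (?I f) S c \<and> is_solution F (?I f) S \<and>
      card (S (length (snd (?I f)))) = del_opt F (?I f)"
    using solves[OF is_instance_gadget_instance] by (simp add: solves_optimally_def)
  then obtain S c where run: "\<And>f. alg_run A (\<phi> (?I f)) (?I f) (S f) (c f)"
    and sol: "\<And>f. is_solution F (?I f) (S f)"
    and opt: "\<And>f. card (S f (length (snd (?I f)))) = del_opt F (?I f)"
    by metis
  have ans: "S f ?n = shared f" if "f \<in> ?P" for f
    using that sol opt del_opt_gadget_instance[of f] by (intro forced_answer) (auto simp: PiE_iff)
  have "\<exists>f\<in>?P. card ?P \<le> 2 ^ c f ?n"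
  proof (rule ex_long_advice[where t = "\<lambda>f. \<phi> (?I f)"])
    show "finite ?P" by (intro finite_PiE) (simp_all add: H.pair_finite_verts)
    show "?P \<noteq> {}" using disc[OF H_in] by (auto simp: PiE_eq_empty_iff disconnected_def)
    fix f f' assume ff': "f \<in> ?P" "f' \<in> ?P"
      and "stake (c f ?n) (\<phi> (?I f)) = stake (c f ?n) (\<phi> (?I f'))"
    \<comment> \<open>Equal advice gives equal answers when the first copies are complete, and these
      answers determine the choice of shared vertices.\<close>
    then have "S f ?n = S f' ?n"
      using alg_run_same_prefix[OF run run length_base_le length_base_le revealed_prefix_base]
      by blast
    then show "f = f'" using ans ff' shared_inj by simp
  qed
  then obtain f where f: "f \<in> ?P" "card ?P \<le> 2 ^ c f ?n" ..
  let ?m = "c f (length (snd (?I f)))"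
  have "card (pverts H) ^ k = card ?P" by (simp add: card_PiE)
  also have "\<dots> \<le> 2 ^ c f ?n" by (rule f(2))
  \<comment> \<open>Bits read after the first copies only add to the total.\<close>
  also have "\<dots> \<le> 2 ^ ?m" using alg_run_mono[OF run length_base_le] by simp
  finally have "card (pverts H) ^ k \<le> 2 ^ ?m" .
  moreover have "reads_bits A (\<phi> (?I f)) (?I f) ?m" unfolding reads_bits_def using run by blast
  moreover have "del_opt F (?I f) = k" using f(1) by (intro del_opt_gadget_instance) auto
  ultimately show ?thesis using is_instance_gadget_instance by blast
qed

end

theorem theorem3:
  fixes F :: "'a pair_pre_digraph set" and H :: "'a pair_pre_digraph"
  assumes "forbidden_family F"
    and "\<forall>G\<in>F. disconnected G"
    and "H \<in> F"
    and "\<forall>G\<in>F. card (pverts G) \<le> card (pverts H)"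
  shows "needs_advice F (\<lambda>k. real k * log 2 (real (card (pverts H))))"
  unfolding needs_advice_def
proof (intro allI impI)
  fix A \<phi> k
  assume solves: "\<forall>I. is_instance I \<longrightarrow> solves_optimally F A (\<phi> I) I"
  have H: "pair_graph H" using assms(1,3) by (simp add: forbidden_family_def)
  then interpret H: pair_graph H .
  obtain g :: "'a \<Rightarrow> nat" where "inj_on g (pverts H)"
    using finite_imp_inj_to_nat_seg[OF H.pair_finite_verts] by metis
  then interpret hard_family F H g k
    using H assms by unfold_locales auto
  have pos: "0 < card (pverts H)"
    using assms(2,3) H.pair_finite_verts by (auto simp: card_gt_0_iff disconnected_def)
  obtain I m where I: "is_instance I" "del_opt F I = k" "reads_bits A (\<phi> I) I m"
    and le: "card (pverts H) ^ k \<le> 2 ^ m"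
    using ex_instance_many_bits solves by blast
  \<comment> \<open>The count of choices becomes a number of bits on taking logarithms;
    \<open>pos\<close> makes them monotone here.\<close>
  have "real k * log 2 (real (card (pverts H))) = log 2 (real (card (pverts H) ^ k))"
    using pos by (simp add: log_nat_power)
  also have "\<dots> \<le> log 2 (real (2 ^ m))"
    using pos le by (subst log_le_cancel_iff) (simp_all only: of_nat_le_iff, simp_all)
  also have "\<dots> = real m" by (simp add: log_nat_power)
  finally show "\<exists>I. is_instance I \<and> del_opt F I = k \<and>
      (\<exists>m. reads_bits A (\<phi> I) I m \<and> real k * log 2 (real (card (pverts H))) \<le> real m)"
    using I by blast
qed

end
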